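(* For every functor $P\colon\mathcal{E}\to\mathcal{B}$ between small categories, $\mathrm{dsecat}(P)\leq\mathrm{secat}(P)$. If $P$ is a Grothendieck opfibration, then $\mathrm{dsecat}(P)=\mathrm{secat}(P)$.
   Context: All categories are small. A cover of a category $\mathcal{B}$ is a family of (not necessarily full) subcategories such that every morphism of $\mathcal{B}$ belongs to at least one of them. For $P\colon\mathcal{E}\to\mathcal{B}$: the sectional category $\mathrm{secat}(P)$ is the least integer $n\geq0$ for which $\mathcal{B}$ admits a cover $\{\mathcal{U}_0,\dots,\mathcal{U}_n\}$ and, for every $i$, a functor $s_i\colon\mathcal{U}_i\to\mathcal{E}$ with $P s_i=\iota_i$, where $\iota_i\colon\mathcal{U}_i\hookrightarrow\mathcal{B}$ is the inclusion. The directed sectional category $\mathrm{dsecat}(P)$ is the least integer $n\geq0$ for which $\mathcal{B}$ admits a cover $\{\mathcal{U}_0,\dots,\mathcal{U}_n\}$ and, for every $i$, a functor $s_i\colon\mathcal{U}_i\to\mathcal{E}$ together with a natural transformation $P s_i\Rightarrow\iota_i$. Each is $\infty$ if no such finite cover exists. A morphism $\varphi\colon e_1\to e_2$ in $\mathcal{E}$ is $P$-opcartesian if for every $\beta\colon e_1\to e$ in $\mathcal{E}$ and every $\overline\alpha\colon P(e_2)\to P(e)$ with $\overline\alpha\circ P(\varphi)=P(\beta)$, there is a unique $\alpha\colon e_2\to e$ with $\alpha\circ\varphi=\beta$ and $P(\alpha)=\overline\alpha$. $P$ is a Grothendieck opfibration if for every morphism $\overline\varphi\colon b_1\to b_2$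 in $\mathcal{B}$ and every $e_1$ with $P(e_1)=b_1$ there is a $P$-opcartesian morphism $\varphi\colon e_1\to e_2$ with $P(\varphi)=\overline\varphi$. *)

theory Defs
  imports "HOL-Library.Extended_Nat"
begin

text \<open>
  Small categories have explicit carriers \<open>Obj\<close> and \<open>Mor\<close>; the values of the structure
  maps outside the carriers (and of \<open>Comp\<close> on non-composable pairs) are irrelevant.
  \<open>Comp C g f\<close> is \<open>g \<circ> f\<close>, i.e. first \<open>f\<close>, then \<open>g\<close>.
\<close>

record ('o, 'm) cat =
  Obj :: "'o set"
  Mor :: "'m set"
  Dom :: "'m \<Rightarrow> 'o"
  Cod :: "'m \<Rightarrow> 'o"
  Ident :: "'o \<Rightarrow> 'm"
  Comp :: "'m \<Rightarrow> 'm \<Rightarrow> 'm"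

definition hom :: "('o, 'm) cat \<Rightarrow> 'o \<Rightarrow> 'o \<Rightarrow> 'm set" where
  "hom C a b = {f \<in> Mor C. Dom C f = a \<and> Cod C f = b}"

locale category =
  fixes C :: "('o, 'm) cat"
  assumes Dom_closed: "f \<in> Mor C \<Longrightarrow> Dom C f \<in> Obj C"
    and Cod_closed: "f \<in> Mor C \<Longrightarrow> Cod C f \<in> Obj C"
    and Ident_hom: "a \<in> Obj C \<Longrightarrow> Ident C a \<in> hom C a a"
    and Comp_hom: "f \<in> hom C a b \<Longrightarrow> g \<in> hom C b c \<Longrightarrow> Comp C g f \<in> hom C a c"
    and Comp_Ident_right: "f \<in> hom C a b \<Longrightarrow> Comp C f (Ident C a) = f"
    and Comp_Ident_left: "f \<in> hom C a b \<Longrightarrow> Comp C (Ident C b) f = f"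
    and Comp_assoc: "f \<in> hom C a b \<Longrightarrow> g \<in> hom C b c \<Longrightarrow> h \<in> hom C c d \<Longrightarrow>
      Comp C h (Comp C g f) = Comp C (Comp C h g) f"

record ('o, 'm, 'p, 'n) ftor =
  Omap :: "'o \<Rightarrow> 'p"
  Mmap :: "'m \<Rightarrow> 'n"

locale cat_functor = source: category C + target: category D
  for C :: "('o, 'm) cat" and D :: "('p, 'n) cat" +
  fixes F :: "('o, 'm, 'p, 'n) ftor"
  assumes Omap_closed: "a \<in> Obj C \<Longrightarrow> Omap F a \<in> Obj D"
    and Mmap_hom: "f \<in> hom C a b \<Longrightarrow> Mmap F f \<in> hom D (Omap F a) (Omap F b)"
    and Mmap_Ident: "a \<in> Obj C \<Longrightarrow> Mmap F (Ident C a) = Ident D (Omap F a)"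
    and Mmap_Comp: "f \<in> hom C a b \<Longrightarrow> g \<in> hom C b c \<Longrightarrow>
      Mmap F (Comp C g f) = Comp D (Mmap F g) (Mmap F f)"

definition ftor_comp ::
    "('p, 'n, 'q, 'k) ftor \<Rightarrow> ('o, 'm, 'p, 'n) ftor \<Rightarrow> ('o, 'm, 'q, 'k) ftor" where
  "ftor_comp G F = \<lparr>Omap = Omap G \<circ> Omap F, Mmap = Mmap G \<circ> Mmap F\<rparr>"

text \<open>The underlying maps of the inclusion of any subcategory.\<close>

definition incl :: "('o, 'm, 'o, 'm) ftor" where
  "incl = \<lparr>Omap = (\<lambda>a. a), Mmap = (\<lambda>f. f)\<rparr>"

text \<open>Equality of functors with source \<open>C\<close>: values outside the carriers of \<open>C\<close> do not count.\<close>

definition ftor_eq ::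
    "('o, 'm) cat \<Rightarrow> ('o, 'm, 'p, 'n) ftor \<Rightarrow> ('o, 'm, 'p, 'n) ftor \<Rightarrow> bool" where
  "ftor_eq C F G \<longleftrightarrow>
    (\<forall>a\<in>Obj C. Omap F a = Omap G a) \<and> (\<forall>f\<in>Mor C. Mmap F f = Mmap G f)"

locale nat_transformation = F: cat_functor C D F + G: cat_functor C D G
  for C :: "('o, 'm) cat" and D :: "('p, 'n) cat" and F G +
  fixes \<eta> :: "'o \<Rightarrow> 'n"
  assumes component_hom: "a \<in> Obj C \<Longrightarrow> \<eta> a \<in> hom D (Omap F a) (Omap G a)"
    and naturality: "f \<in> hom C a b \<Longrightarrow>
      Comp D (\<eta> b) (Mmap F f) = Comp D (Mmap G f) (\<eta> a)"

definition subcategory :: "('o, 'm) cat \<Rightarrow> ('o, 'm) cat \<Rightarrow> bool" where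
  "subcategory U B \<longleftrightarrow> category U \<and> category B \<and> Obj U \<subseteq> Obj B \<and> Mor U \<subseteq> Mor B \<and>
    (\<forall>f\<in>Mor U. Dom U f = Dom B f \<and> Cod U f = Cod B f) \<and>
    (\<forall>a\<in>Obj U. Ident U a = Ident B a) \<and>
    (\<forall>f\<in>Mor U. \<forall>g\<in>Mor U. Cod U f = Dom U g \<longrightarrow> Comp U g f = Comp B g f)"

definition cover :: "('o, 'm) cat \<Rightarrow> 'i set \<Rightarrow> ('i \<Rightarrow> ('o, 'm) cat) \<Rightarrow> bool" where
  "cover B I U \<longleftrightarrow> (\<forall>i\<in>I. subcategory (U i) B) \<and> (\<forall>f\<in>Mor B. \<exists>i\<in>I. f \<in> Mor (U i))"

text \<open>In \<open>enat\<close> the infimum of the empty set is \<open>\<infinity>\<close>.\<close>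

definition secat ::
    "('a, 'e) cat \<Rightarrow> ('b, 'm) cat \<Rightarrow> ('a, 'e, 'b, 'm) ftor \<Rightarrow> enat" where
  "secat E B P = Inf {enat n | n. \<exists>U. cover B {0..n} U \<and>
    (\<forall>i\<in>{0..n}. \<exists>s. cat_functor (U i) E s \<and> ftor_eq (U i) (ftor_comp P s) incl)}"

definition dsecat ::
    "('a, 'e) cat \<Rightarrow> ('b, 'm) cat \<Rightarrow> ('a, 'e, 'b, 'm) ftor \<Rightarrow> enat" where
  "dsecat E B P = Inf {enat n | n. \<exists>U. cover B {0..n} U \<and>
    (\<forall>i\<in>{0..n}. \<exists>s \<eta>. cat_functor (U i) E s \<and>
      nat_transformation (U i) B (ftor_comp P s) incl \<eta>)}"

definition opcartesian ::
    "('a, 'e) cat \<Rightarrow> ('b, 'm) cat \<Rightarrow> ('a, 'e, 'b, 'm) ftor \<Rightarrow> 'e \<Rightarrow> bool" where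
  "opcartesian E B P \<phi> \<longleftrightarrow> \<phi> \<in> Mor E \<and>
    (\<forall>e\<in>Obj E. \<forall>\<beta>\<in>hom E (Dom E \<phi>) e. \<forall>\<alpha>'\<in>hom B (Omap P (Cod E \<phi>)) (Omap P e).
      Comp B \<alpha>' (Mmap P \<phi>) = Mmap P \<beta> \<longrightarrow>
      (\<exists>!\<alpha>. \<alpha> \<in> hom E (Cod E \<phi>) e \<and> Comp E \<alpha> \<phi> = \<beta> \<and> Mmap P \<alpha> = \<alpha>'))"

definition opfibration ::
    "('a, 'e) cat \<Rightarrow> ('b, 'm) cat \<Rightarrow> ('a, 'e, 'b, 'm) ftor \<Rightarrow> bool" where
  "opfibration E B P \<longleftrightarrow> cat_functor E B P \<and>
    (\<forall>b\<^sub>1\<in>Obj B. \<forall>b\<^sub>2\<in>Obj B. \<forall>\<phi>'\<in>hom B b\<^sub>1 b\<^sub>2. \<forall>e\<^sub>1\<in>Obj E. Omap P e\<^sub>1 = b\<^sub>1 \<longrightarrow>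
      (\<exists>e\<^sub>2\<in>Obj E. \<exists>\<phi>\<in>hom E e\<^sub>1 e\<^sub>2. opcartesian E B P \<phi> \<and> Mmap P \<phi> = \<phi>'))"

end

theory Submission
  imports Defs
begin

text \<open>
  A strict section is a directed one whose natural transformation has identity components.
  Conversely, over an opfibration, pushing a directed section \<open>s\<close> forward along the components
  \<open>P (s a) \<rightarrow> a\<close> of its natural transformation gives a strict section: the universal property of
  the opcartesian lifts determines its action on morphisms, and uniqueness makes it functorial.
\<close>

lemma hom_iff: "f \<in> hom C a b \<longleftrightarrow> f \<in> Mor C \<and> Dom C f = a \<and> Cod C f = b"
  by (simp add: hom_def)

lemma Omap_ftor_comp [simp]: "Omap (ftor_comp G F) a = Omap G (Omap F a)"
  and Mmap_ftor_comp [simp]: "Mmap (ftor_comp G F) f = Mmap G (Mmap F f)"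
  and Omap_incl [simp]: "Omap incl a = a"
  and Mmap_incl [simp]: "Mmap incl f = f"
  by (simp_all add: ftor_comp_def incl_def)

lemma (in category) hom_obj:
  assumes "f \<in> hom C a b"
  shows "a \<in> Obj C" and "b \<in> Obj C"
  using assms Dom_closed Cod_closed by (auto simp: hom_iff)

lemma cat_functor_ftor_comp:
  assumes "cat_functor C D F" and "cat_functor D K G"
  shows "cat_functor C K (ftor_comp G F)"
proof -
  interpret F: cat_functor C D F by fact
  interpret G: cat_functor D K G by fact
  show ?thesis
    by unfold_locales
      (simp_all add: F.Omap_closed G.Omap_closed F.Mmap_Ident G.Mmap_Ident
        F.Mmap_hom G.Mmap_hom F.Mmap_Comp G.Mmap_Comp[OF F.Mmap_hom F.Mmap_hom])
qed

lemma subcategory_hom: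
  assumes "subcategory U B" and "f \<in> hom U a b"
  shows "f \<in> hom B a b"
  using assms by (auto simp: subcategory_def hom_iff)

lemma subcategory_Comp:
  assumes "subcategory U B" and "f \<in> hom U a b" and "g \<in> hom U b c"
  shows "Comp U g f = Comp B g f"
  using assms by (simp add: subcategory_def hom_iff)

lemma cat_functor_incl:
  assumes "subcategory U B"
  shows "cat_functor U B incl"
proof -
  interpret U: category U using assms by (simp add: subcategory_def)
  interpret B: category B using assms by (simp add: subcategory_def)
  show ?thesis
  proof
    show "Omap incl a \<in> Obj B" if "a \<in> Obj U" for a
      using assms that by (auto simp: subcategory_def)
    show "Mmap incl (Ident U a) = Ident B (Omap incl a)" if "a \<in> Obj U" for a
      using assms that by (simp add: subcategory_def)
  qed (simp_all add: subcategory_hom[OF assms] subcategory_Comp[OF assms])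
qed

text \<open>Naturality reduces to the two unit laws of \<open>B\<close>, because \<open>P\<close>
  after \<open>s\<close> fixes every morphism of \<open>U\<close>.\<close>

lemma strict_section_imp_directed_section:
  assumes P: "cat_functor E B P" and sub: "subcategory U B"
    and s: "cat_functor U E s" and eq: "ftor_eq U (ftor_comp P s) incl"
  shows "nat_transformation U B (ftor_comp P s) incl (Ident B)"
proof -
  interpret Ps: cat_functor U B "ftor_comp P s"
    using s P by (rule cat_functor_ftor_comp)
  interpret incl: cat_functor U B incl
    using sub by (rule cat_functor_incl)
  show ?thesis
  proof
    fix a assume a: "a \<in> Obj U"
    with sub have "a \<in> Obj B" by (auto simp: subcategory_def)
    \<comment> \<open>The section equation on objects turns the source \<open>P (s a)\<close> into
      \<open>a\<close>, so an identity of \<open>B\<close> has the right type.\<close>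
    with a eq show "Ident B a \<in> hom B (Omap (ftor_comp P s) a) (Omap incl a)"
      by (simp add: ftor_eq_def Ps.target.Ident_hom)
  next
    fix f a b assume f: "f \<in> hom U a b"
    from f eq have "Mmap (ftor_comp P s) f = f"
      by (simp add: ftor_eq_def hom_iff)
    moreover from sub f have "f \<in> hom B a b" by (rule subcategory_hom)
    ultimately show "Comp B (Ident B b) (Mmap (ftor_comp P s) f) =
        Comp B (Mmap incl f) (Ident B a)"
      using Ps.target.Comp_Ident_left Ps.target.Comp_Ident_right by simp
  qed
qed

text \<open>The definition of an opfibration says nothing about the object under
  \<open>e\<^sub>2\<close>; comparing codomains in \<open>Mmap P \<phi> = \<phi>'\<close> shows that
  it is \<open>b\<close>. This is what will make the pushed-forward section strict on
  objects.\<close>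

lemma opfibrationE:
  assumes "opfibration E B P" and "\<phi>' \<in> hom B (Omap P e\<^sub>1) b" and "e\<^sub>1 \<in> Obj E"
  obtains e\<^sub>2 \<phi> where "\<phi> \<in> hom E e\<^sub>1 e\<^sub>2" and "opcartesian E B P \<phi>"
    and "Mmap P \<phi> = \<phi>'" and "Omap P e\<^sub>2 = b"
proof -
  interpret P: cat_functor E B P using assms(1) by (simp add: opfibration_def)
  from P.target.hom_obj[OF assms(2)] assms
  obtain e\<^sub>2 \<phi> where \<phi>: "\<phi> \<in> hom E e\<^sub>1 e\<^sub>2" "opcartesian E B P \<phi>" "Mmap P \<phi> = \<phi>'"
    unfolding opfibration_def by blast
  from P.Mmap_hom[OF \<phi>(1)] \<phi>(3) assms(2) have "Omap P e\<^sub>2 = b"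
    by (simp add: hom_iff)
  with \<phi> that show thesis by blast
qed

text \<open>The universal property with the endpoints of \<open>\<phi>\<close> named, so that it
  applies to lifts whose domain and codomain are known only through hom-membership.\<close>

lemma opcartesian_lift:
  assumes "opcartesian E B P \<phi>" and "\<phi> \<in> hom E e\<^sub>1 e\<^sub>2" and "e \<in> Obj E"
    and "\<beta> \<in> hom E e\<^sub>1 e" and "\<alpha>' \<in> hom B (Omap P e\<^sub>2) (Omap P e)"
    and "Comp B \<alpha>' (Mmap P \<phi>) = Mmap P \<beta>"
  shows "\<exists>!\<alpha>. \<alpha> \<in> hom E e\<^sub>2 e \<and> Comp E \<alpha> \<phi> = \<beta> \<and> Mmap P \<alpha> = \<alpha>'"
  using assms unfolding opcartesian_def hom_iff[of \<phi>] by blast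

lemma directed_section_imp_strict_section:
  assumes opf: "opfibration E B P" and sub: "subcategory U B"
    and s: "cat_functor U E s" and nat: "nat_transformation U B (ftor_comp P s) incl \<eta>"
  shows "\<exists>t. cat_functor U E t \<and> ftor_eq U (ftor_comp P t) incl"
proof -
  interpret P: cat_functor E B P using opf by (simp add: opfibration_def)
  interpret s: cat_functor U E s by fact
  interpret \<eta>: nat_transformation U B "ftor_comp P s" incl \<eta> by fact
  have "\<exists>e \<phi>. \<phi> \<in> hom E (Omap s a) e \<and> opcartesian E B P \<phi> \<and> Mmap P \<phi> = \<eta> a \<and> Omap P e = a"
    if "a \<in> Obj U" for a
    using opfibrationE[OF opf, of "\<eta> a" "Omap s a" a] \<eta>.component_hom[OF that]
      s.Omap_closed[OF that] by (simp, metis)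
  \<comment> \<open>One lift per object is chosen, independently of the others; coherence between
    them will come from uniqueness of fillers.\<close>
  then obtain e \<phi> where \<phi>: "\<And>a. a \<in> Obj U \<Longrightarrow> \<phi> a \<in> hom E (Omap s a) (e a)"
    and opc: "\<And>a. a \<in> Obj U \<Longrightarrow> opcartesian E B P (\<phi> a)"
    and P_\<phi>: "\<And>a. a \<in> Obj U \<Longrightarrow> Mmap P (\<phi> a) = \<eta> a"
    and P_e: "\<And>a. a \<in> Obj U \<Longrightarrow> Omap P (e a) = a"
    by metis
  note e = P.source.hom_obj(2)[OF \<phi>]
  \<comment> \<open>\<open>\<alpha>\<close> lies over \<open>f\<close> and completes the square with
    sides \<open>\<phi> a\<close>, \<open>\<phi> b\<close> and top \<open>Mmap s f\<close>. Taking
    the endpoints from \<open>f\<close> itself makes the filler \<open>t f\<close> depend on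
    \<open>f\<close> alone.\<close>
  define lift where "lift f \<alpha> \<longleftrightarrow> \<alpha> \<in> hom E (e (Dom U f)) (e (Cod U f)) \<and>
    Comp E \<alpha> (\<phi> (Dom U f)) = Comp E (\<phi> (Cod U f)) (Mmap s f) \<and> Mmap P \<alpha> = f" for f \<alpha>
  define t where "t f = (THE \<alpha>. lift f \<alpha>)" for f
  have ex1: "\<exists>!\<alpha>. lift f \<alpha>" if f: "f \<in> hom U a b" for f a b
  proof -
    note ab = s.source.hom_obj[OF f]
    \<comment> \<open>Naturality of \<eta> at \<open>f\<close> is the compatibility in
      \<open>B\<close> that the universal property of \<open>\<phi> a\<close> asks for, with \<beta>
      the composite of \<open>Mmap s f\<close> and \<open>\<phi> b\<close>.\<close>
    have "Comp B f (Mmap P (\<phi> a)) = Comp B (\<eta> b) (Mmap P (Mmap s f))"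
      using \<eta>.naturality[OF f] ab by (simp add: P_\<phi>)
    also have "\<dots> = Mmap P (Comp E (\<phi> b) (Mmap s f))"
      using P.Mmap_Comp[OF s.Mmap_hom[OF f] \<phi>] ab by (simp add: P_\<phi>)
    finally have "\<exists>!\<alpha>. \<alpha> \<in> hom E (e a) (e b) \<and>
        Comp E \<alpha> (\<phi> a) = Comp E (\<phi> b) (Mmap s f) \<and> Mmap P \<alpha> = f"
      using ab subcategory_hom[OF sub f]
      by (intro opcartesian_lift[OF opc \<phi>])
        (simp_all add: e P_e P.source.Comp_hom[OF s.Mmap_hom[OF f] \<phi>])
    with f show ?thesis by (simp add: lift_def hom_iff[of f])
  qed
  have t: "lift f (t f)" if "f \<in> hom U a b" for f a b
    unfolding t_def using ex1[OF that] by (rule theI')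
  \<comment> \<open>Both functor laws follow from this: it suffices that the expected value of
    \<open>t\<close> fills the square.\<close>
  have t_eq: "t f = \<alpha>" if "f \<in> hom U a b" and "lift f \<alpha>" for f a b \<alpha>
    using ex1[OF that(1)] that(2) t[OF that(1)] by blast
  have t_hom: "t f \<in> hom E (e a) (e b)"
    and t_\<phi>: "Comp E (t f) (\<phi> a) = Comp E (\<phi> b) (Mmap s f)"
    and P_t: "Mmap P (t f) = f" if "f \<in> hom U a b" for f a b
    using t[OF that] that by (simp_all add: lift_def hom_iff[of f])
  have t_Ident: "t (Ident U a) = Ident E (e a)" if a: "a \<in> Obj U" for a
  proof (rule t_eq)
    show id: "Ident U a \<in> hom U a a" using a by (rule s.source.Ident_hom)
    \<comment> \<open>\<open>P\<close> yields the identity of \<open>B\<close> at \<open>a\<close>,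
      which is that of \<open>U\<close> since \<open>U\<close> is a subcategory.\<close>
    have "Mmap P (Ident E (e a)) = Ident U a"
      using a sub by (simp add: P.Mmap_Ident e P_e subcategory_def)
    moreover have "Comp E (Ident E (e a)) (\<phi> a) = Comp E (\<phi> a) (Mmap s (Ident U a))"
      using P.source.Comp_Ident_left[OF \<phi>[OF a]] P.source.Comp_Ident_right[OF \<phi>[OF a]] a
      by (simp add: s.Mmap_Ident)
    ultimately show "lift (Ident U a) (Ident E (e a))"
      using id P.source.Ident_hom[OF e[OF a]] by (simp add: lift_def hom_iff[of "Ident U a"])
  qed
  have t_Comp: "t (Comp U g f) = Comp E (t g) (t f)"
    if f: "f \<in> hom U a b" and g: "g \<in> hom U b c" for f g a b c
  proof (rule t_eq)
    show gf: "Comp U g f \<in> hom U a c" using f g by (rule s.source.Comp_hom)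
    note ab = s.source.hom_obj[OF f] and c = s.source.hom_obj(2)[OF g]
    \<comment> \<open>Pasting the squares of \<open>f\<close> and \<open>g\<close> along
      \<open>\<phi> b\<close> gives a square for their composite.\<close>
    have "Comp E (Comp E (t g) (t f)) (\<phi> a) = Comp E (t g) (Comp E (t f) (\<phi> a))"
      by (rule P.source.Comp_assoc[OF \<phi>[OF ab(1)] t_hom[OF f] t_hom[OF g], symmetric])
    also have "\<dots> = Comp E (t g) (Comp E (\<phi> b) (Mmap s f))"
      by (simp only: t_\<phi>[OF f])
    also have "\<dots> = Comp E (Comp E (t g) (\<phi> b)) (Mmap s f)"
      by (rule P.source.Comp_assoc[OF s.Mmap_hom[OF f] \<phi>[OF ab(2)] t_hom[OF g]])
    also have "\<dots> = Comp E (Comp E (\<phi> c) (Mmap s g)) (Mmap s f)"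
      by (simp only: t_\<phi>[OF g])
    also have "\<dots> = Comp E (\<phi> c) (Comp E (Mmap s g) (Mmap s f))"
      by (rule P.source.Comp_assoc[OF s.Mmap_hom[OF f] s.Mmap_hom[OF g] \<phi>[OF c], symmetric])
    also have "\<dots> = Comp E (\<phi> c) (Mmap s (Comp U g f))"
      by (simp only: s.Mmap_Comp[OF f g])
    finally have "Comp E (Comp E (t g) (t f)) (\<phi> a) = Comp E (\<phi> c) (Mmap s (Comp U g f))" .
    moreover have "Mmap P (Comp E (t g) (t f)) = Comp U g f"
      using P.Mmap_Comp[OF t_hom[OF f] t_hom[OF g]] subcategory_Comp[OF sub f g]
      by (simp add: P_t[OF f] P_t[OF g])
    ultimately show "lift (Comp U g f) (Comp E (t g) (t f))"
      using gf P.source.Comp_hom[OF t_hom[OF f] t_hom[OF g]]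
      by (simp add: lift_def hom_iff[of "Comp U g f"])
  qed
  let ?t = "\<lparr>Omap = e, Mmap = t\<rparr>"
  have "cat_functor U E ?t"
    by unfold_locales (simp_all add: e t_hom t_Ident t_Comp)
  moreover have "ftor_eq U (ftor_comp P ?t) incl"
    \<comment> \<open>The instance of \<open>P_t\<close> puts a morphism of \<open>U\<close> into
      the hom-set of its own domain and codomain.\<close>
    by (simp add: ftor_eq_def P_e P_t[OF iffD2[OF hom_iff]])
  ultimately show ?thesis by blast
qed

theorem proposition6p4:
  fixes E :: "('a, 'e) cat" and B :: "('b, 'm) cat" and P :: "('a, 'e, 'b, 'm) ftor"
  assumes "category E" and "category B" and "cat_functor E B P"
  shows "dsecat E B P \<le> secat E B P \<and>
    (opfibration E B P \<longrightarrow> dsecat E B P = secat E B P)"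
proof -
  \<comment> \<open>Every \<open>n\<close> admissible for \<open>secat\<close> is admissible for
    \<open>dsecat\<close> with the same cover, and the infimum over a larger set is smaller. An
    empty set, with infimum \<infinity>, is covered too.\<close>
  have "dsecat E B P \<le> secat E B P"
    unfolding dsecat_def secat_def
  proof (rule Inf_superset_mono, rule subsetI)
    fix k
    assume "k \<in> {enat n | n. \<exists>U. cover B {0..n} U \<and>
      (\<forall>i\<in>{0..n}. \<exists>s. cat_functor (U i) E s \<and> ftor_eq (U i) (ftor_comp P s) incl)}"
    then obtain n U where "k = enat n" and U: "cover B {0..n} U"
      and s: "\<forall>i\<in>{0..n}. \<exists>s. cat_functor (U i) E s \<and> ftor_eq (U i) (ftor_comp P s) incl"
      by auto
    moreover have "\<exists>s \<eta>. cat_functor (U i) E s \<and>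
        nat_transformation (U i) B (ftor_comp P s) incl \<eta>" if i: "i \<in> {0..n}" for i
    proof -
      from U i have sub: "subcategory (U i) B" by (simp add: cover_def)
      from s i obtain s where "cat_functor (U i) E s" "ftor_eq (U i) (ftor_comp P s) incl"
        by blast
      with strict_section_imp_directed_section[OF assms(3) sub] show ?thesis by blast
    qed
    ultimately show "k \<in> {enat n | n. \<exists>U. cover B {0..n} U \<and>
      (\<forall>i\<in>{0..n}. \<exists>s \<eta>. cat_functor (U i) E s \<and>
        nat_transformation (U i) B (ftor_comp P s) incl \<eta>)}"
      by blast
  qed
  \<comment> \<open>The reverse inclusion of the admissible sets: the cover is again kept, and each
    directed section is replaced by a strict one.\<close>
  moreover have "secat E B P \<le> dsecat E B P" if opf: "opfibration E B P"
    unfolding dsecat_def secat_def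
  proof (rule Inf_superset_mono, rule subsetI)
    fix k
    assume "k \<in> {enat n | n. \<exists>U. cover B {0..n} U \<and>
      (\<forall>i\<in>{0..n}. \<exists>s \<eta>. cat_functor (U i) E s \<and>
        nat_transformation (U i) B (ftor_comp P s) incl \<eta>)}"
    then obtain n U where "k = enat n" and U: "cover B {0..n} U"
      and s: "\<forall>i\<in>{0..n}. \<exists>s \<eta>. cat_functor (U i) E s \<and>
        nat_transformation (U i) B (ftor_comp P s) incl \<eta>"
      by auto
    moreover have "\<exists>t. cat_functor (U i) E t \<and> ftor_eq (U i) (ftor_comp P t) incl"
      if i: "i \<in> {0..n}" for i
    proof -
      from U i have sub: "subcategory (U i) B" by (simp add: cover_def)
      from s i obtain s \<eta> where "cat_functor (U i) E s"
        "nat_transformation (U i) B (ftor_comp P s) incl \<eta>"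
        by blast
      with directed_section_imp_strict_section[OF opf sub] show ?thesis by blast
    qed
    ultimately show "k \<in> {enat n | n. \<exists>U. cover B {0..n} U \<and>
      (\<forall>i\<in>{0..n}. \<exists>s. cat_functor (U i) E s \<and> ftor_eq (U i) (ftor_comp P s) incl)}"
      by blast
  qed
  ultimately show ?thesis by (simp add: order.antisym)
qed

end
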